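(* Let $\lambda_1,\dots,\lambda_n>0$ and $\mu_1>\mu_2>\cdots>\mu_n>0$ be given and let the service times be exponential, i.e. $v_i=2/\mu_i^2$ for all $i$. For any optimal solution $(\boldsymbol x^*,\alpha^* )$ of the queue partition problem $$(\mathrm{QPP})\qquad\inf_{\boldsymbol x,\alpha}\ f(\boldsymbol x,\alpha)\quad\text{s.t. }(\boldsymbol x,\alpha)\in\mathcal F,\ 0\le\alpha\le1,\ x_i\in[0,1],\ i=1,\dots,n,$$ there exists $i^*\in\{0,1,\dots,n\}$ such that either $$x_i^*=\begin{cases}1&\text{if }i\le i^*\\0&\text{if }i>i^*\end{cases}\ \text{ for all }i,\qquad\text{or}\qquad x_i^*=\begin{cases}0&\text{if }i\le i^*\\1&\text{if }i>i^*\end{cases}\ \text{ for all }i.$$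
   Context: There are $n$ customer types; type $i$ arrives as a Poisson process with rate $\lambda_i$ and has an exponential service time with rate $\mu_i$ under a unit-capacity server. Unit capacity is split into two queues with capacities $\alpha$ and $1-\alpha$; $x_i$ is the probability that a type $i$ customer is assigned to the first queue. The expected waiting time is, for $0<\alpha<1$, $$f(\boldsymbol x,\alpha)=\frac{\sum_i\frac{\lambda_ix_i}{\mu_i^2}}{\alpha^2-\alpha\sum_i\frac{\lambda_ix_i}{\mu_i}}\cdot\frac{\sum_ix_i\lambda_i}{\sum_i\lambda_i}+\frac{\sum_i\frac{\lambda_i(1-x_i)}{\mu_i^2}}{(1-\alpha)^2-(1-\alpha)\sum_i\frac{\lambda_i(1-x_i)}{\mu_i}}\cdot\frac{\sum_i(1-x_i)\lambda_i}{\sum_i\lambda_i},$$ and $f(\boldsymbol 0,0)=f(\boldsymbol 1,1)=\left(\sum_i\lambda_i/\mu_i^2\right)/\left(1-\sum_i\lambda_i/\mu_i\right)$. The feasible set $\mathcal F$ consists of the pairs $(\boldsymbol x,\alpha)$ with $0<\alpha<1$ and $\sum_i\frac{\lambda_ix_i}{\mu_i}<\alpha<\sum_i\frac{\lambda_ix_i}{\mu_i}+1-\sum_i\frac{\lambda_i}{\mu_i}$, together with $(\boldsymbol 0,0)$ and $(\boldsymbol 1,1)$ (where $\sum_i\lambda_i/\mu_i<1$). *)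

theory Defs
  imports Complex_Main
begin

text \<open>Customer types are indexed by \<open>{1..n}\<close>. The vectors \<open>lam\<close> (arrival rates), \<open>mu\<close> (service
  rates) and \<open>x\<close> (probabilities of being assigned to the first queue) are functions on \<^typ>\<open>nat\<close>;
  only their values on \<open>{1..n}\<close> are ever used.\<close>

text \<open>The value at \<open>(\<zero>, 0)\<close> and \<open>(\<one>, 1)\<close> is that of a single queue of unit capacity. The formula is
  the one for exponential service times, whose second moments \<open>v\<^sub>i = 2 / mu\<^sub>i\<^sup>2\<close> are already substituted.
  It is meaningful at feasible points only; there, both denominators of the last branch are
  positive.\<close>

definition waiting_time ::
  "nat \<Rightarrow> (nat \<Rightarrow> real) \<Rightarrow> (nat \<Rightarrow> real) \<Rightarrow> (nat \<Rightarrow> real) \<Rightarrow> real \<Rightarrow> real" where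
  "waiting_time n lam mu x \<alpha> =
    (if ((\<forall>i\<in>{1..n}. x i = 0) \<and> \<alpha> = 0) \<or> ((\<forall>i\<in>{1..n}. x i = 1) \<and> \<alpha> = 1)
     then (\<Sum>i=1..n. lam i / (mu i)\<^sup>2) / (1 - (\<Sum>i=1..n. lam i / mu i))
     else
       (\<Sum>i=1..n. lam i * x i / (mu i)\<^sup>2) / (\<alpha>\<^sup>2 - \<alpha> * (\<Sum>i=1..n. lam i * x i / mu i))
         * ((\<Sum>i=1..n. x i * lam i) / (\<Sum>i=1..n. lam i))
       + (\<Sum>i=1..n. lam i * (1 - x i) / (mu i)\<^sup>2)
           / ((1 - \<alpha>)\<^sup>2 - (1 - \<alpha>) * (\<Sum>i=1..n. lam i * (1 - x i) / mu i))
         * ((\<Sum>i=1..n. (1 - x i) * lam i) / (\<Sum>i=1..n. lam i)))"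

definition stable_set ::
  "nat \<Rightarrow> (nat \<Rightarrow> real) \<Rightarrow> (nat \<Rightarrow> real) \<Rightarrow> ((nat \<Rightarrow> real) \<times> real) set" where
  "stable_set n lam mu =
    {(x, \<alpha>). 0 < \<alpha> \<and> \<alpha> < 1 \<and>
       (\<Sum>i=1..n. lam i * x i / mu i) < \<alpha> \<and>
       \<alpha> < (\<Sum>i=1..n. lam i * x i / mu i) + 1 - (\<Sum>i=1..n. lam i / mu i)}
    \<union> {(x, \<alpha>). (\<forall>i\<in>{1..n}. x i = 0) \<and> \<alpha> = 0}
    \<union> {(x, \<alpha>). (\<forall>i\<in>{1..n}. x i = 1) \<and> \<alpha> = 1}"

definition qpp_feasible ::
  "nat \<Rightarrow> (nat \<Rightarrow> real) \<Rightarrow> (nat \<Rightarrow> real) \<Rightarrow> (nat \<Rightarrow> real) \<Rightarrow> real \<Rightarrow> bool" where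
  "qpp_feasible n lam mu x \<alpha> \<longleftrightarrow>
     (x, \<alpha>) \<in> stable_set n lam mu \<and> 0 \<le> \<alpha> \<and> \<alpha> \<le> 1 \<and> (\<forall>i\<in>{1..n}. 0 \<le> x i \<and> x i \<le> 1)"

definition qpp_optimal ::
  "nat \<Rightarrow> (nat \<Rightarrow> real) \<Rightarrow> (nat \<Rightarrow> real) \<Rightarrow> (nat \<Rightarrow> real) \<Rightarrow> real \<Rightarrow> bool" where
  "qpp_optimal n lam mu x \<alpha> \<longleftrightarrow>
     qpp_feasible n lam mu x \<alpha> \<and>
     (\<forall>y \<beta>. qpp_feasible n lam mu y \<beta> \<longrightarrow> waiting_time n lam mu x \<alpha> \<le> waiting_time n lam mu y \<beta>)"

end

theory Submission
  imports Defs
begin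

text \<open>
  Write \<open>a, b, c\<close> for the sums of \<open>lam\<^sub>i x\<^sub>i / mu\<^sub>i\<^sup>j\<close>, \<open>j = 0, 1, 2\<close>, and \<open>a', b', c'\<close> for those
  of the second queue; up to a constant factor the objective is \<open>P + Q\<close> with \<open>P = a c / (\<alpha> (\<alpha> - b))\<close>
  and \<open>Q\<close> likewise. Its derivative in \<open>x\<^sub>i\<close> is \<open>lam\<^sub>i\<close> times a quadratic
  \<open>g\<^sub>0 + g\<^sub>1 t + g\<^sub>2 t\<^sup>2\<close> in \<open>t = 1 / mu\<^sub>i\<close> whose coefficients do not depend on \<open>i\<close>. At an optimum the
  first-order conditions exclude that \<open>g\<^sub>0\<close> and \<open>g\<^sub>2\<close> are both \<open>\<ge> 0\<close> and, exchanging the queues, that both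
  are \<open>\<le> 0\<close>; the only degenerate possibility is an even split, which is twice as bad as a single queue.
  Hence the quadratic has exactly one positive root, and \<open>x\<close> is of threshold form except for at
  most one fractional type. If type \<open>i\<close> is fractional, then \<open>P\<close> and \<open>Q\<close> have opposite gradients in
  \<open>(x\<^sub>i, \<alpha>)\<close>, hence a common level direction, and along it (up to a small tilt) the second
  derivative of \<open>P + Q\<close> is negative.
\<close>

subsection \<open>First and second order conditions along a line\<close>

text \<open>This is the cost \<open>a * c / (\<alpha> * (\<alpha> - b))\<close> of one queue along a
  line, with \<open>p\<close> for \<open>\<alpha>\<close> and \<open>s\<close> for
  \<open>\<alpha> - b\<close>. Taking \<open>s\<close> as a factor of its own makes all four factors
  affine in \<open>e\<close>.\<close>

definition line_cost :: "real \<Rightarrow> real \<Rightarrow> real \<Rightarrow> real \<Rightarrow> real \<Rightarrow> real \<Rightarrow> real \<Rightarrow> real \<Rightarrow> real \<Rightarrow> real" where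
  "line_cost a c p s da dc dp ds e = (a + e * da) * (c + e * dc) / ((p + e * dp) * (s + e * ds))"

definition line_log_deriv :: "real \<Rightarrow> real \<Rightarrow> real \<Rightarrow> real \<Rightarrow> real \<Rightarrow> real \<Rightarrow> real \<Rightarrow> real \<Rightarrow> real \<Rightarrow> real" where
  "line_log_deriv a c p s da dc dp ds e =
     da / (a + e * da) + dc / (c + e * dc) - dp / (p + e * dp) - ds / (s + e * ds)"

lemma line_cost_deriv:
  assumes "a + e * da \<noteq> 0" "c + e * dc \<noteq> 0" "p + e * dp \<noteq> 0" "s + e * ds \<noteq> 0"
  shows "(line_cost a c p s da dc dp ds has_real_derivative
           line_cost a c p s da dc dp ds e * line_log_deriv a c p s da dc dp ds e) (at e)"
proof -
  define A C U V where "A = a + e * da" and "C = c + e * dc" and "U = p + e * dp" and "V = s + e * ds"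
  have nz: "A \<noteq> 0" "C \<noteq> 0" "U \<noteq> 0" "V \<noteq> 0"
    using assms by (auto simp: A_def C_def U_def V_def)
  define N' D' where "N' = da * C + A * dc" and "D' = dp * V + U * ds"
  have N: "((\<lambda>e. (a + e * da) * (c + e * dc)) has_real_derivative N') (at e)"
    unfolding N'_def A_def C_def by (auto intro!: derivative_eq_intros)
  have D: "((\<lambda>e. (p + e * dp) * (s + e * ds)) has_real_derivative D') (at e)"
    unfolding D'_def U_def V_def by (auto intro!: derivative_eq_intros)
  have "((\<lambda>e. (a + e * da) * (c + e * dc) / ((p + e * dp) * (s + e * ds))) has_real_derivative
      (N' * (U * V) - A * C * D') / (U * V * (U * V))) (at e)"
    using DERIV_divide[OF N D] nz by (simp add: A_def C_def U_def V_def)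
  moreover have "(N' * (U * V) - A * C * D') / (U * V * (U * V)) = A * C / (U * V) * (N' / (A * C) - D' / (U * V))"
    using nz by (simp add: diff_divide_distrib right_diff_distrib)
  moreover have "N' / (A * C) - D' / (U * V) = da / A + dc / C - dp / U - ds / V"
    using nz by (simp add: N'_def D'_def add_divide_distrib)
  ultimately show ?thesis
    by (simp add: line_cost_def[abs_def] line_log_deriv_def A_def C_def U_def V_def)
qed

lemma line_log_deriv_deriv0:
  assumes "a \<noteq> 0" "c \<noteq> 0" "p \<noteq> 0" "s \<noteq> 0"
  shows "(line_log_deriv a c p s da dc dp ds has_real_derivative
            (dp / p)\<^sup>2 + (ds / s)\<^sup>2 - (da / a)\<^sup>2 - (dc / c)\<^sup>2) (at 0)"
proof -
  have quot: "((\<lambda>e. x / (y + e * x)) has_real_derivative - (x / y)\<^sup>2) (at 0)" if "y \<noteq> 0" for x y :: real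
    using that by (auto intro!: derivative_eq_intros simp: power2_eq_square)
  have "((\<lambda>e. da / (a + e * da) + dc / (c + e * dc) - dp / (p + e * dp) - ds / (s + e * ds))
      has_real_derivative - (da / a)\<^sup>2 + - (dc / c)\<^sup>2 - - (dp / p)\<^sup>2 - - (ds / s)\<^sup>2) (at 0)"
    by (intro DERIV_add DERIV_diff quot assms)
  then show ?thesis by (simp add: line_log_deriv_def[abs_def] algebra_simps)
qed

text \<open>Only a one-sided minimum is available in general: a type with \<open>x i\<close> equal
  to 0 or 1 can be moved in one direction only.\<close>

lemma deriv_at_right_min_nonneg:
  fixes f :: "real \<Rightarrow> real"
  assumes "(f has_real_derivative D) (at 0)" and "\<forall>\<^sub>F h in at_right 0. f 0 \<le> f h"
  shows "0 \<le> D"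
proof (rule ccontr)
  assume "\<not> 0 \<le> D"
  then obtain d where d: "d > 0" "\<And>h. 0 < h \<Longrightarrow> h < d \<Longrightarrow> f h < f 0"
    using DERIV_neg_dec_right[OF assms(1)] by auto
  have "\<forall>\<^sub>F h in at_right (0::real). 0 < h \<and> h < d"
    unfolding eventually_at_right_field using d(1) by auto
  with assms(2) have "\<forall>\<^sub>F h in at_right (0::real). False"
    by eventually_elim (use d(2) in force)
  then show False by simp
qed

lemma deriv2_at_right_min_nonneg:
  fixes f f' :: "real \<Rightarrow> real"
  assumes f: "\<forall>\<^sub>F h in nhds 0. (f has_real_derivative f' h) (at h)"
    and f'0: "f' 0 = 0"
    and f': "(f' has_real_derivative D) (at 0)"
    and min: "\<forall>\<^sub>F h in at_right 0. f 0 \<le> f h"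
  shows "0 \<le> D"
proof (rule ccontr)
  assume "\<not> 0 \<le> D"
  then obtain d where d: "d > 0" "\<And>h. 0 < h \<Longrightarrow> h < d \<Longrightarrow> f' h < 0"
    using DERIV_neg_dec_right[OF f'] f'0 by auto
  obtain d' where d': "d' > 0" "\<And>h. \<bar>h\<bar> < d' \<Longrightarrow> (f has_real_derivative f' h) (at h)"
    using f unfolding eventually_nhds_metric by (auto simp: dist_real_def)
  have "\<forall>\<^sub>F h in at_right (0::real). 0 < h \<and> h < min d d'"
    unfolding eventually_at_right_field using d(1) d'(1) by (intro exI[of _ "min d d'"]) auto
  with min have "\<forall>\<^sub>F h in at_right (0::real). False"
  proof eventually_elim
    case (elim h)
    have "\<exists>z>0. z < h \<and> f h - f 0 = (h - 0) * f' z"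
      by (rule MVT2) (use elim d'(2) in auto)
    then obtain z where "0 < z" "z < h" "f h - f 0 = h * f' z" by auto
    moreover have "f' z < 0" using d(2) \<open>0 < z\<close> \<open>z < h\<close> elim by simp
    ultimately show False using elim mult_pos_neg[of h "f' z"] by simp
  qed
  then show False by simp
qed

text \<open>A function with value \<open>P\<close> and logarithmic derivative \<open>u\<close> has
  second derivative \<open>P\<close> times the sum of \<open>u\<^sup>2\<close> and the derivative of
  its logarithmic derivative. This explains the brackets in the second claim.\<close>

lemma two_line_costs_deriv:
  fixes a c p s a' c' p' s' da dc dp ds da' dc' dp' ds' :: real
  assumes "a > 0" "c > 0" "p > 0" "s > 0" "a' > 0" "c' > 0" "p' > 0" "s' > 0"
  defines "F \<equiv> \<lambda>e. line_cost a c p s da dc dp ds e + line_cost a' c' p' s' da' dc' dp' ds' e"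
  assumes min: "\<forall>\<^sub>F e in at_right 0. F 0 \<le> F e"
  defines "P \<equiv> a * c / (p * s)" and "Q \<equiv> a' * c' / (p' * s')"
  shows two_line_costs_deriv_nonneg:
      "0 \<le> P * (da / a + dc / c - dp / p - ds / s) + Q * (da' / a' + dc' / c' - dp' / p' - ds' / s')"
    and two_line_costs_deriv2_nonneg:
      "da / a + dc / c - dp / p - ds / s = u \<Longrightarrow>
       da' / a' + dc' / c' - dp' / p' - ds' / s' = v \<Longrightarrow> P * u + Q * v = 0 \<Longrightarrow>
       0 \<le> P * (u\<^sup>2 + ((dp / p)\<^sup>2 + (ds / s)\<^sup>2 - (da / a)\<^sup>2 - (dc / c)\<^sup>2))
         + Q * (v\<^sup>2 + ((dp' / p')\<^sup>2 + (ds' / s')\<^sup>2 - (da' / a')\<^sup>2 - (dc' / c')\<^sup>2))"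
proof -
  define L M where "L = line_cost a c p s da dc dp ds" and "M = line_cost a' c' p' s' da' dc' dp' ds'"
  define L' M' where "L' = line_log_deriv a c p s da dc dp ds"
    and "M' = line_log_deriv a' c' p' s' da' dc' dp' ds'"
  define G where "G = (\<lambda>e. L e * L' e + M e * M' e)"
  have ev: "\<forall>\<^sub>F e in nhds 0. a + e * da > 0" if "a > 0" for a da :: real
  proof -
    have "((\<lambda>e. a + e * da) \<longlongrightarrow> a + 0 * da) (nhds 0)"
      by (intro tendsto_intros filterlim_ident)
    then show ?thesis using that by (auto dest: order_tendstoD(1)[where a = 0])
  qed
  have F: "F = (\<lambda>e. L e + M e)" by (simp add: F_def L_def M_def)
  have dF: "\<forall>\<^sub>F e in nhds 0. (F has_real_derivative G e) (at e)"
    using ev[OF assms(1), of da] ev[OF assms(2), of dc] ev[OF assms(3), of dp] ev[OF assms(4), of ds]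
      ev[OF assms(5), of da'] ev[OF assms(6), of dc'] ev[OF assms(7), of dp'] ev[OF assms(8), of ds']
  proof eventually_elim
    case (elim e)
    show ?case unfolding F G_def L_def M_def L'_def M'_def
      by (intro DERIV_add line_cost_deriv) (use elim in auto)
  qed
  have vals: "L 0 = P" "M 0 = Q" "L' 0 = da / a + dc / c - dp / p - ds / s"
      "M' 0 = da' / a' + dc' / c' - dp' / p' - ds' / s'"
    by (simp_all add: L_def M_def L'_def M'_def line_cost_def line_log_deriv_def P_def Q_def)
  show "0 \<le> P * (da / a + dc / c - dp / p - ds / s) + Q * (da' / a' + dc' / c' - dp' / p' - ds' / s')"
    using deriv_at_right_min_nonneg[OF eventually_nhds_x_imp_x[OF dF] min] by (simp add: G_def vals)
  assume u: "da / a + dc / c - dp / p - ds / s = u"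
    and v: "da' / a' + dc' / c' - dp' / p' - ds' / s' = v" and 0: "P * u + Q * v = 0"
  have G0: "G 0 = 0" using 0 by (simp add: G_def vals u v)
  have "(L has_real_derivative L 0 * L' 0) (at 0)" "(M has_real_derivative M 0 * M' 0) (at 0)"
    unfolding L_def M_def L'_def M'_def by (intro line_cost_deriv; use assms(1-8) in simp)+
  then have dG: "(G has_real_derivative
      L 0 * L' 0 * L' 0 + ((dp / p)\<^sup>2 + (ds / s)\<^sup>2 - (da / a)\<^sup>2 - (dc / c)\<^sup>2) * L 0
      + (M 0 * M' 0 * M' 0 + ((dp' / p')\<^sup>2 + (ds' / s')\<^sup>2 - (da' / a')\<^sup>2 - (dc' / c')\<^sup>2) * M 0)) (at 0)"
    unfolding G_def L'_def M'_def
    by (intro DERIV_add DERIV_mult line_log_deriv_deriv0; use assms(1-8) in simp)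
  show "0 \<le> P * (u\<^sup>2 + ((dp / p)\<^sup>2 + (ds / s)\<^sup>2 - (da / a)\<^sup>2 - (dc / c)\<^sup>2))
         + Q * (v\<^sup>2 + ((dp' / p')\<^sup>2 + (ds' / s')\<^sup>2 - (da' / a')\<^sup>2 - (dc' / c')\<^sup>2))"
    using deriv2_at_right_min_nonneg[OF dF G0 dG min]
    unfolding vals(1,2) vals(3)[unfolded u] vals(4)[unfolded v]
    by (simp add: ring_distribs power2_eq_square mult.commute mult.left_commute)
qed

subsection \<open>Real inequalities\<close>

text \<open>Excludes that the first queue serves only types of intermediate service rate: this
  is the sign pattern \<open>ga, gc \<ge> 0 > gb\<close> of the quadratic.\<close>
lemma first_order_contradiction:
  fixes a b c s a' b' c' r P Q ga gb gc :: real
  assumes pos: "a > 0" "b > 0" "c > 0" "s > 0" "a' > 0" "b' > 0" "c' > 0" "r > 0"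
    and P_def: "P = a * c / ((s + b) * s)" and Q_def: "Q = a' * c' / ((r + b') * r)"
    and ga_def: "ga = P / a - Q / a'" and gb_def: "gb = P / s - Q / r" and gc_def: "gc = P / c - Q / c'"
    and stat: "P * (1 / (s + b) + 1 / s) = Q * (1 / (r + b') + 1 / r)"
    and sgn: "ga \<ge> 0" "gc \<ge> 0" "gb < 0"
    and agg: "ga * a + gb * b + gc * c \<le> 0" "0 \<le> ga * a' + gb * b' + gc * c'"
  shows False
proof -
  \<comment> \<open>Everything is expressed by ratios of the first queue to the second;
    \<open>A\<close> compares the capacities \<open>s + b\<close> and \<open>r + b'\<close>,
    \<open>S\<close> the slacks.\<close>
  define A S u v w rho where "A = (s + b) / (r + b')" and "S = s / r" and "u = a / a'"
    and "v = b / b'" and "w = c / c'" and "rho = P / Q"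
  have P: "P > 0" and Q: "Q > 0" and pos': "s + b > 0" "r + b' > 0"
    using pos by (simp_all add: P_def Q_def)
  have uvw: "A > 0" "S > 0" "u > 0" "v > 0" "w > 0" "rho > 0"
    using pos pos' P Q by (simp_all add: A_def S_def u_def v_def w_def rho_def)
  have eqs: "s + b = A * (r + b')" "s = S * r" "a = u * a'" "b = v * b'" "c = w * c'" "P = rho * Q"
    using pos pos' Q by (simp_all add: A_def S_def u_def v_def w_def rho_def)
  have rho: "rho * (A * S) = u * w"
  proof -
    have "a * c / (p * s) / (a' * c' / (q * r)) * (p / q * (s / r)) = a / a' * (c / c')"
      if "p \<noteq> 0" "q \<noteq> 0" for p q :: real
      using pos that by simp
    from this[of "s + b" "r + b'"] show ?thesis
      using pos' by (simp only: rho_def P_def Q_def A_def S_def u_def w_def)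
  qed
  have ga: "ga = Q / a' * (rho / u - 1)" and gc: "gc = Q / c' * (rho / w - 1)"
    and gb: "gb = Q / r * (rho / S - 1)"
    using pos uvw unfolding ga_def gb_def gc_def eqs(2,3,5,6) by (simp_all add: field_simps)
  have le: "u \<le> rho" "w \<le> rho" "rho < S"
    using sgn pos uvw Q unfolding ga gb gc
    by (simp_all add: zero_le_mult_iff mult_less_0_iff field_simps)
  have stat': "(rho - A) / (s + b) = (S - rho) / s"
  proof -
    have "rho * (1 / (s + b) + 1 / s) = 1 / (r + b') + 1 / r"
      using stat Q unfolding eqs(6) by (simp add: mult.assoc mult.left_commute)
    moreover have "1 / (r + b') = A / (s + b)" "1 / r = S / s"
      using pos pos' by (simp_all add: A_def S_def)
    ultimately show ?thesis by (simp add: ring_distribs diff_divide_distrib)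
  qed
  have "(S - rho) / s > 0" using le pos by simp
  then have A: "A < rho" unfolding stat'[symmetric] using pos' by (simp add: zero_less_divide_iff)
  \<comment> \<open>\<open>A\<close> is the mean of \<open>S\<close> and \<open>v\<close> with
    weights \<open>r\<close> and \<open>b'\<close>, so \<open>A < S\<close> pushes \<open>v\<close>
    below \<open>A\<close>.\<close>
  have v: "v < A"
  proof -
    have "A * r + A * b' = S * r + v * b'" using eqs(1,2,4) by (simp add: algebra_simps)
    moreover have "A * r < S * r" using A le pos by simp
    ultimately have "v * b' < A * b'" by linarith
    then show ?thesis using pos by simp
  qed
  have AS: "A * S \<le> u" "A * S \<le> w"
  proof -
    have "rho * (A * S) \<le> u * rho" "rho * (A * S) \<le> rho * w"
      unfolding rho using le uvw by (simp_all add: mult_left_mono mult_right_mono)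
    then show "A * S \<le> u" "A * S \<le> w" using uvw by (simp_all add: mult.commute)
  qed
  \<comment> \<open>Otherwise the two aggregate inequalities, the second multiplied by
    \<open>v\<close>, force \<open>ga = gc = 0\<close>, and then the second one fails because
    \<open>gb < 0\<close>.\<close>
  have "u \<le> v \<or> w \<le> v"
  proof (rule ccontr)
    assume "\<not> (u \<le> v \<or> w \<le> v)"
    then have uv: "u > v" "w > v" by auto
    have "ga * a + gc * c \<le> v * (ga * a' + gc * c')"
    proof -
      have "ga * a + gc * c \<le> v * (- gb * b')"
        using agg(1) unfolding eqs(4) by (simp add: algebra_simps)
      also have "\<dots> \<le> v * (ga * a' + gc * c')"
        using agg(2) uvw by (intro mult_left_mono) auto
      finally show ?thesis .
    qed
    then have "ga * a' * (u - v) + gc * c' * (w - v) \<le> 0"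
      unfolding eqs(3,5) by (simp add: algebra_simps)
    moreover have "ga * a' * (u - v) \<ge> 0" "gc * c' * (w - v) \<ge> 0"
      using uv sgn pos by simp_all
    ultimately have "ga * a' * (u - v) = 0" "gc * c' * (w - v) = 0" by linarith+
    then have "ga = 0" "gc = 0" using uv pos by simp_all
    then have "0 \<le> gb * b'" using agg(2) by simp
    then show False using sgn(3) pos by (simp add: zero_le_mult_iff)
  qed
  \<comment> \<open>\<open>A * S\<close> is at most both \<open>u\<close> and \<open>w\<close>, one
    of which is at most \<open>v\<close>, and \<open>v < A\<close>.\<close>
  then have "A * S < A * 1" using AS v by auto
  then have S1: "S < 1" using uvw by simp
  have "rho * (u + w) \<le> rho * (rho + A * S)"
  proof -
    have "0 \<le> (rho - u) * (rho - w)" using le by simp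
    then show ?thesis using rho by (simp add: algebra_simps)
  qed
  then have "u + w \<le> rho + A * S" using uvw by simp
  moreover have "2 * rho - u - w \<le> b * ((S - rho) / s)"
  proof -
    have "ga * a + gb * b + gc * c = Q * (2 * rho - u - w - b * ((S - rho) / s))"
      unfolding ga gb gc eqs(3,5) using pos uvw by (simp add: eqs(2) field_simps)
    then show ?thesis using agg(1) Q by (simp add: mult_le_0_iff)
  qed
  moreover have "b * ((S - rho) / s) < rho - A"
    unfolding stat'[symmetric] using A pos pos' by (simp add: pos_divide_less_eq)
  \<comment> \<open>The three estimates combine to \<open>rho + A < u + w\<close> and
    \<open>u + w \<le> rho + A * S\<close>.\<close>
  ultimately have "A * 1 < A * S" by simp
  then show False using S1 uvw by simp
qed

text \<open>The equations make the data of the two queues proportional with factor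
  \<open>P / Q\<close>. The cost is homogeneous of degree 0, so \<open>P = Q\<close> and the factor
  is 1.\<close>

lemma all_gradients_zero:
  fixes a b c s a' b' c' r P Q :: real
  assumes pos: "a > 0" "b > 0" "c > 0" "s > 0" "a' > 0" "b' > 0" "c' > 0" "r > 0"
    and P_def: "P = a * c / ((s + b) * s)" and Q_def: "Q = a' * c' / ((r + b') * r)"
    and stat: "P * (1 / (s + b) + 1 / s) = Q * (1 / (r + b') + 1 / r)"
    and eq: "P / a = Q / a'" "P / c = Q / c'" "P / s = Q / r"
  shows "a = a' \<and> c = c' \<and> s = r \<and> b = b'"
proof -
  have P: "P > 0" and Q: "Q > 0" and pos': "s + b > 0" "r + b' > 0"
    using pos by (simp_all add: P_def Q_def)
  define k where "k = P / Q"
  have k: "k > 0" "P = k * Q" using P Q by (simp_all add: k_def)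
  have "P / (s + b) = Q / (r + b')" using stat eq(3) by (simp add: ring_distribs)
  then have e: "s + b = k * (r + b')" "a = k * a'" "c = k * c'" "s = k * r"
    using eq Q pos pos' unfolding k(2) by (simp_all add: field_simps)
  have "P = Q"
    unfolding P_def e(1) unfolding e(2,3,4) Q_def using k by simp
  then have "k = 1" using Q by (simp add: k_def)
  then show ?thesis using e by simp
qed

text \<open>Here \<open>e1, e2, k, l\<close> are reciprocals, namely the logarithmic derivatives of the factors of
  \<open>a c / (\<alpha> (\<alpha> - b))\<close> for a direction with \<open>db = 1\<close>: \<open>k = 1 / \<alpha>\<close>, \<open>l = 1 / (\<alpha> - b)\<close>, so that
  \<open>k l / (l - k) = 1 / b\<close>. The speed \<open>1 + nu\<close> of \<open>\<alpha>\<close> is the one that keeps the quotient stationary.\<close>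
lemma level_direction_bound:
  fixes e1 e2 k l nu :: real
  assumes "0 < k" "k < l" and e: "0 < e1" "0 < e2" and nu: "e1 + e2 = k + nu * (k + l)"
    and y: "(e1 - k * l / (l - k)) * (e2 - k * l / (l - k)) \<le> 0"
  shows "e1 * e2 \<le> (1 + nu) * k * (nu * l)" and "0 < nu"
proof -
  define y where "y = k * l / (l - k)"
  have y_pos: "y > k" using assms(1,2) by (simp add: y_def field_simps)
  have 1: "k - y = - (k * (k / (l - k)))" "y = l * (k / (l - k))"
    using assms(1,2) by (simp_all add: y_def field_simps)
  \<comment> \<open>By the choice of \<open>nu\<close>, the pairs \<open>e1, e2\<close> and
    \<open>(1 + nu) * k, nu * l\<close> have equal sums, so their products compare as do the
    products of their differences to \<open>y\<close>. These are nonpositive for the first pair by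
    assumption, and a square times \<open>k * l\<close> for the second.\<close>
  have "((1 + nu) * k - y) * (nu * l - y) = k * l * (nu - k / (l - k))\<^sup>2"
  proof -
    have "(1 + nu) * k - y = k * (nu - k / (l - k))" using 1(1) by (simp add: algebra_simps)
    moreover have "nu * l - y = l * (nu - k / (l - k))" using 1(2) by (simp add: algebra_simps)
    ultimately show ?thesis by (simp add: power2_eq_square)
  qed
  then have "0 \<le> ((1 + nu) * k - y) * (nu * l - y)" using assms(1,2) by simp
  moreover have "e1 * e2 - (e1 + e2) * y + y * y \<le> 0" using y[folded y_def] by (simp add: algebra_simps)
  ultimately show "e1 * e2 \<le> (1 + nu) * k * (nu * l)" unfolding nu by (simp add: algebra_simps)
  have "e1 \<ge> y \<or> e2 \<ge> y" using y by (auto simp: y_def mult_le_0_iff)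
  then have "0 < nu * (k + l)" using e nu y_pos by auto
  then show "0 < nu" using assms(1,2) by (simp add: zero_less_mult_iff)
qed

text \<open>\<open>H K\<close> is the second derivative of the total cost when \<open>b\<close>
  moves at speed 1 and \<open>\<alpha>\<close> at speed \<open>K\<close>. The two stationarity
  equations give both queues the same \<open>nu\<close>, so at \<open>K = 1 + nu\<close> both costs
  are stationary and \<open>level_direction_bound\<close> makes both brackets nonpositive.\<close>

lemma second_order_direction:
  fixes e1 e2 k l e1' e2' k' l' P Q :: real
  assumes P: "0 < P" and Q: "0 < Q"
    and k: "0 < k" "k < l" "0 < k'" "k' < l'"
    and e: "0 < e1" "0 < e2" "0 < e1'" "0 < e2'"
    and stat_k: "P * (k + l) = Q * (k' + l')"
    and stat_e: "P * (e1 + e2 + l) = Q * (e1' + e2' + l')"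
    and y: "(e1 - k * l / (l - k)) * (e2 - k * l / (l - k)) \<le> 0"
    and y': "(e1' - k' * l' / (l' - k')) * (e2' - k' * l' / (l' - k')) \<le> 0"
  defines "H \<equiv> \<lambda>K. P * ((e1 + e2 - K * k - (K - 1) * l)\<^sup>2 + (K * k)\<^sup>2 + ((K - 1) * l)\<^sup>2 - e1\<^sup>2 - e2\<^sup>2)
      + Q * ((e1' + e2' - K * k' - (K - 1) * l')\<^sup>2 + (K * k')\<^sup>2 + ((K - 1) * l')\<^sup>2 - e1'\<^sup>2 - e2'\<^sup>2)"
  shows "\<exists>K. H K < 0"
proof -
  define nu where "nu = (e1 + e2 - k) / (k + l)"
  have nu: "e1 + e2 = k + nu * (k + l)" using k by (simp add: nu_def)
  have nu': "e1' + e2' = k' + nu * (k' + l')"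
  proof -
    have "Q * (e1' + e2' - k') = P * (e1 + e2 - k)" using stat_k stat_e by (simp add: algebra_simps)
    also have "\<dots> = nu * (P * (k + l))" unfolding nu by simp
    also have "\<dots> = Q * (nu * (k' + l'))" unfolding stat_k by simp
    finally show ?thesis using Q by simp
  qed
  note b = level_direction_bound[OF k(1,2) e(1,2) nu y]
  note b' = level_direction_bound[OF k(3,4) e(3,4) nu' y']
  \<comment> \<open>\<open>H (1 + nu - h)\<close> will be at most twice
    \<open>- h * J + h\<^sup>2 * R\<close>, which is negative at its minimiser
    \<open>J / (2 * R)\<close>.\<close>
  define J where "J = P * (k\<^sup>2 + nu * (k\<^sup>2 + l\<^sup>2)) + Q * (k'\<^sup>2 + nu * (k'\<^sup>2 + l'\<^sup>2))"
  define R where "R = P * (k\<^sup>2 + l\<^sup>2 + k * l) + Q * (k'\<^sup>2 + l'\<^sup>2 + k' * l')"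
  have J: "J > 0" and R: "R > 0"
    unfolding J_def R_def using P Q k b(2) by (intro add_pos_pos mult_pos_pos; simp)+
  have expand: "(E - K * k - (K - 1) * l)\<^sup>2 + (K * k)\<^sup>2 + ((K - 1) * l)\<^sup>2 - e1\<^sup>2 - e2\<^sup>2
      = 2 * (e1 * e2 - (1 + nu) * k * (nu * l) - h * (k\<^sup>2 + nu * (k\<^sup>2 + l\<^sup>2)) + h\<^sup>2 * (k\<^sup>2 + l\<^sup>2 + k * l))"
    if "K = 1 + nu - h" "E = e1 + e2" "E = k + nu * (k + l)" for E K h e1 e2 k l :: real
  proof -
    have "e1\<^sup>2 + e2\<^sup>2 = E\<^sup>2 - 2 * e1 * e2" using that(2) by (simp add: power2_eq_square algebra_simps)
    then show ?thesis unfolding that(1) that(3)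
      by (simp add: power2_eq_square algebra_simps)
  qed
  \<comment> \<open>Along the common level direction the bound may only give \<open>H \<le> 0\<close>; the tilt by \<open>h\<close> makes it strict.\<close>
  define h where "h = J / (2 * R)"
  have "H (1 + nu - h) = 2 * (P * (e1 * e2 - (1 + nu) * k * (nu * l)) + Q * (e1' * e2' - (1 + nu) * k' * (nu * l'))
      - h * J + h\<^sup>2 * R)"
    unfolding H_def expand[OF refl refl nu] expand[OF refl refl nu'] J_def R_def
    by (simp add: algebra_simps)
  also have "\<dots> \<le> 2 * (- h * J + h\<^sup>2 * R)"
    using mult_left_mono[OF b(1), of P] mult_left_mono[OF b'(1), of Q] P Q
    by (simp add: algebra_simps)
  also have "- h * J + h\<^sup>2 * R = - J\<^sup>2 / (4 * R)"
    using R by (simp add: h_def power2_eq_square field_simps)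
  finally have "H (1 + nu - h) < 0"
    using J R by (smt (verit) divide_pos_pos divide_minus_left zero_less_power)
  then show ?thesis ..
qed

subsection \<open>Optimality conditions of the queue partition problem\<close>

definition moment :: "nat \<Rightarrow> (nat \<Rightarrow> real) \<Rightarrow> (nat \<Rightarrow> real) \<Rightarrow> nat \<Rightarrow> (nat \<Rightarrow> real) \<Rightarrow> real" where
  "moment n lam mu j x = (\<Sum>i=1..n. lam i * x i / mu i ^ j)"

definition queue_cost :: "nat \<Rightarrow> (nat \<Rightarrow> real) \<Rightarrow> (nat \<Rightarrow> real) \<Rightarrow> (nat \<Rightarrow> real) \<Rightarrow> real \<Rightarrow> real" where
  "queue_cost n lam mu x \<alpha> =
     moment n lam mu 0 x * moment n lam mu 2 x / (\<alpha> * (\<alpha> - moment n lam mu 1 x))"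

lemma moment_fun_upd:
  assumes "i \<in> {1..n}"
  shows "moment n lam mu j (x(i := x i + h)) = moment n lam mu j x + lam i * h / mu i ^ j"
proof -
  have "moment n lam mu j (x(i := x i + h))
      = (\<Sum>k=1..n. lam k * x k / mu k ^ j + (if k = i then lam i * h / mu i ^ j else 0))"
    unfolding moment_def by (intro sum.cong) (auto simp: ring_distribs add_divide_distrib)
  then show ?thesis using assms by (simp add: sum.distrib moment_def)
qed

lemma moment_compl:
  "moment n lam mu j (\<lambda>i. 1 - x i) = (\<Sum>i=1..n. lam i / mu i ^ j) - moment n lam mu j x"
  by (simp add: moment_def right_diff_distrib diff_divide_distrib sum_subtractf)

lemma waiting_time_interior:
  assumes "0 < \<alpha>" "\<alpha> < 1"
  shows "waiting_time n lam mu x \<alpha> =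
    (queue_cost n lam mu x \<alpha> + queue_cost n lam mu (\<lambda>i. 1 - x i) (1 - \<alpha>)) / (\<Sum>i=1..n. lam i)"
  using assms
  by (simp add: waiting_time_def queue_cost_def moment_def power2_eq_square right_diff_distrib
      add_divide_distrib mult.commute)

lemma waiting_time_swap:
  assumes "0 < \<beta>" "\<beta> < 1"
  shows "waiting_time n lam mu (\<lambda>i. 1 - y i) (1 - \<beta>) = waiting_time n lam mu y \<beta>"
  using assms by (simp add: waiting_time_interior add.commute)

text \<open>The assumptions are symmetric in the two queues, so each fact about the first transfers
  to the second through \<open>swap\<close>. That both queues are used makes all moments and both
  costs positive.\<close>

locale interior_optimum =
  fixes n :: nat and lam mu x :: "nat \<Rightarrow> real" and \<alpha> :: real
  assumes lam_pos: "\<And>i. i \<in> {1..n} \<Longrightarrow> 0 < lam i"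
    and mu_pos: "\<And>i. i \<in> {1..n} \<Longrightarrow> 0 < mu i"
    and load: "(\<Sum>i=1..n. lam i / mu i) < 1"
    and box: "\<And>i. i \<in> {1..n} \<Longrightarrow> 0 \<le> x i" "\<And>i. i \<in> {1..n} \<Longrightarrow> x i \<le> 1"
    and \<alpha>_bounds: "0 < \<alpha>" "\<alpha> < 1"
    and slack: "moment n lam mu 1 x < \<alpha>"
    and slack': "moment n lam mu 1 (\<lambda>i. 1 - x i) < 1 - \<alpha>"
    and used: "\<exists>i\<in>{1..n}. x i \<noteq> 0"
    and used': "\<exists>i\<in>{1..n}. x i \<noteq> 1"
    and minimal: "\<And>y \<beta>. qpp_feasible n lam mu y \<beta> \<Longrightarrow>
      waiting_time n lam mu x \<alpha> \<le> waiting_time n lam mu y \<beta>"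
begin

abbreviation m :: "nat \<Rightarrow> real" where "m j \<equiv> moment n lam mu j x"
abbreviation m' :: "nat \<Rightarrow> real" where "m' j \<equiv> moment n lam mu j (\<lambda>i. 1 - x i)"
abbreviation P :: real where "P \<equiv> queue_cost n lam mu x \<alpha>"
abbreviation Q :: real where "Q \<equiv> queue_cost n lam mu (\<lambda>i. 1 - x i) (1 - \<alpha>)"
abbreviation s :: real where "s \<equiv> \<alpha> - m 1"
abbreviation r :: real where "r \<equiv> 1 - \<alpha> - m' 1"

text \<open>\<open>g0\<close>, \<open>g1\<close>, \<open>g2\<close> are the derivatives of
  \<open>P + Q\<close> in \<open>m 0\<close>, \<open>m 1\<close>, \<open>m 2\<close>, the moments of
  the second queue falling at the rate at which those of the first rise.\<close>

definition "g0 = P / m 0 - Q / m' 0"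
definition "g1 = P / s - Q / r"
definition "g2 = P / m 2 - Q / m' 2"
definition "slope i = g0 + g1 / mu i + g2 / (mu i)\<^sup>2"

text \<open>The competing points stay the same; only the value at the optimum has to be invariant
  under the exchange.\<close>

lemma swap: "interior_optimum n lam mu (\<lambda>i. 1 - x i) (1 - \<alpha>)"
  using lam_pos mu_pos load box \<alpha>_bounds slack slack' used used' minimal waiting_time_swap[OF \<alpha>_bounds, of _ _ _ x]
  by unfold_locales auto

lemma swap_g:
  "interior_optimum.g0 n lam mu (\<lambda>i. 1 - x i) (1 - \<alpha>) = - g0"
  "interior_optimum.g2 n lam mu (\<lambda>i. 1 - x i) (1 - \<alpha>) = - g2"
  by (simp_all add: interior_optimum.g0_def[OF swap] interior_optimum.g2_def[OF swap] g0_def g2_def)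

lemma moment_pos: "0 < m j"
proof -
  obtain i where "i \<in> {1..n}" "x i \<noteq> 0" using used by auto
  then have "0 < lam i * x i / mu i ^ j"
    using lam_pos[of i] mu_pos[of i] box(1)[of i] by simp
  then show ?thesis unfolding moment_def
    using \<open>i \<in> {1..n}\<close> lam_pos mu_pos box(1) by (intro sum_pos2[of _ i]) (auto simp: less_imp_le)
qed

lemma moment_pos': "0 < m' j"
  using interior_optimum.moment_pos[OF swap] .

lemma cost_pos: "0 < P" "0 < Q"
  using moment_pos moment_pos' \<alpha>_bounds slack slack' by (simp_all add: queue_cost_def)

text \<open>Here \<open>x i\<close> moves at speed \<open>d\<close> and \<open>\<alpha>\<close> at
  speed \<open>K\<close>. The stability inequalities are strict and survive small moves, so only the
  box constraint on \<open>x i\<close> has to be assumed.\<close>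

lemma line_min:
  fixes d K :: real
  assumes i: "i \<in> {1..n}"
    and in_box: "\<forall>\<^sub>F e in at_right 0. 0 \<le> x i + e * d \<and> x i + e * d \<le> 1"
  defines "F \<equiv> \<lambda>e. line_cost (m 0) (m 2) \<alpha> s (lam i * d) (lam i * d / (mu i)\<^sup>2) K (K - lam i * d / mu i) e
    + line_cost (m' 0) (m' 2) (1 - \<alpha>) r (- (lam i * d)) (- (lam i * d / (mu i)\<^sup>2)) (- K) (- (K - lam i * d / mu i)) e"
  shows "\<forall>\<^sub>F e in at_right 0. F 0 \<le> F e"
proof -
  define y where "y = (\<lambda>e. x(i := x i + e * d))"
  define L where "L = (\<Sum>i=1..n. lam i)"
  have L: "L > 0" unfolding L_def using i lam_pos by (intro sum_pos) auto
  have mom: "moment n lam mu j (y e) = m j + e * (lam i * d / mu i ^ j)" for j e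
    using moment_fun_upd[OF i] by (simp add: y_def mult.left_commute)
  have mom': "moment n lam mu j (\<lambda>k. 1 - y e k) = m' j - e * (lam i * d / mu i ^ j)" for j e
    unfolding moment_compl mom by simp
  have F: "F e = queue_cost n lam mu (y e) (\<alpha> + e * K) + queue_cost n lam mu (\<lambda>k. 1 - y e k) (1 - (\<alpha> + e * K))" for e
    unfolding F_def line_cost_def queue_cost_def mom mom' by (simp add: algebra_simps)
  have ev: "\<forall>\<^sub>F e in at_right 0. a + e * da > 0" if "a > 0" for a da :: real
  proof -
    have "((\<lambda>e. a + e * da) \<longlongrightarrow> a + 0 * da) (at_right 0)"
      by (intro tendsto_intros)
    then show ?thesis using that by (auto dest: order_tendstoD(1)[where a = 0])
  qed
  have F0: "waiting_time n lam mu x \<alpha> = F 0 / L"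
    using \<alpha>_bounds by (simp add: F y_def L_def waiting_time_interior)
  have "\<alpha> > 0" "1 - \<alpha> > 0" "s > 0" "r > 0" using \<alpha>_bounds slack slack' by auto
  from this[THEN ev, of K] this[THEN ev, of "- K"]
    this[THEN ev, of "K - lam i * d / mu i"] this[THEN ev, of "- (K - lam i * d / mu i)"] in_box
  show ?thesis
  proof eventually_elim
    case (elim e)
    have "qpp_feasible n lam mu (y e) (\<alpha> + e * K)"
    proof -
      have "moment n lam mu 1 (y e) < \<alpha> + e * K"
        "moment n lam mu 1 (\<lambda>k. 1 - y e k) < 1 - (\<alpha> + e * K)"
        unfolding mom mom' using elim by (simp_all add: algebra_simps)
      then have "(\<Sum>i=1..n. lam i * y e i / mu i) < \<alpha> + e * K"
        "\<alpha> + e * K < (\<Sum>i=1..n. lam i * y e i / mu i) + 1 - (\<Sum>i=1..n. lam i / mu i)"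
        unfolding moment_compl by (simp_all add: moment_def)
      then show ?thesis using elim box
        by (auto simp: qpp_feasible_def stable_set_def y_def)
    qed
    then have "F 0 / L \<le> waiting_time n lam mu (y e) (\<alpha> + e * K)"
      unfolding F0[symmetric] by (rule minimal)
    also have "\<dots> = F e / L"
      using elim by (simp add: waiting_time_interior F L_def)
    finally show ?case using L by (simp add: divide_le_cancel)
  qed
qed

section \<open>First-order conditions at an interior optimum\<close>

lemma line_deriv:
  assumes "i \<in> {1..n}"
    and "\<forall>\<^sub>F e in at_right 0. 0 \<le> x i + e * d \<and> x i + e * d \<le> 1"
  shows "0 \<le> P * (lam i * d / m 0 + lam i * d / (mu i)\<^sup>2 / m 2 - K / \<alpha> - (K - lam i * d / mu i) / s)
    + Q * (- (lam i * d) / m' 0 + - (lam i * d / (mu i)\<^sup>2) / m' 2 - - K / (1 - \<alpha>) - - (K - lam i * d / mu i) / r)"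
proof -
  have pos: "\<alpha> > 0" "1 - \<alpha> > 0" "s > 0" "r > 0" using \<alpha>_bounds slack slack' by auto
  show ?thesis
    using two_line_costs_deriv_nonneg[OF moment_pos moment_pos pos(1,3) moment_pos' moment_pos' pos(2,4)
        line_min[OF assms]]
    unfolding queue_cost_def .
qed

lemma stationary_capacity: "P * (1 / \<alpha> + 1 / s) = Q * (1 / (1 - \<alpha>) + 1 / r)"
proof -
  obtain i where i: "i \<in> {1..n}" using used by auto
  have "\<forall>\<^sub>F e in at_right 0. 0 \<le> x i + e * 0 \<and> x i + e * 0 \<le> 1" using box i by simp
  \<comment> \<open>With \<open>d = 0\<close> the vector \<open>x\<close> is fixed, so
    \<open>\<alpha>\<close> may move both ways and the inequality becomes an equation.\<close>
  from line_deriv[OF i this, of 1] line_deriv[OF i this, of "-1"]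
  show ?thesis by (simp add: algebra_simps)
qed

text \<open>The zero terms are kept so that the left side is literally the case \<open>K = 0\<close>
  of \<open>line_deriv\<close>.\<close>

lemma slope_eq:
  "P * (lam i * d / m 0 + lam i * d / (mu i)\<^sup>2 / m 2 - 0 / \<alpha> - (0 - lam i * d / mu i) / s)
    + Q * (- (lam i * d) / m' 0 + - (lam i * d / (mu i)\<^sup>2) / m' 2 - - 0 / (1 - \<alpha>) - - (0 - lam i * d / mu i) / r)
   = lam i * d * slope i"
  by (simp add: slope_def g0_def g1_def g2_def diff_divide_distrib ring_distribs mult.commute mult.left_commute)

lemma slope_nonneg:
  assumes i: "i \<in> {1..n}" and "x i < 1"
  shows "0 \<le> slope i"
proof -
  have "\<forall>\<^sub>F e in at_right 0. 0 \<le> x i + e * 1 \<and> x i + e * 1 \<le> 1"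
    unfolding eventually_at_right_field using assms box by (intro exI[of _ "1 - x i"]) force
  from line_deriv[OF i this, of 0] show ?thesis
    unfolding slope_eq using lam_pos[OF i] by (simp add: zero_le_mult_iff)
qed

lemma slope_nonpos:
  assumes i: "i \<in> {1..n}" and "0 < x i"
  shows "slope i \<le> 0"
proof -
  have "\<forall>\<^sub>F e in at_right 0. 0 \<le> x i + e * (-1) \<and> x i + e * (-1) \<le> 1"
    unfolding eventually_at_right_field using assms box by (intro exI[of _ "x i"]) force
  from line_deriv[OF i this, of 0] show ?thesis
    unfolding slope_eq using lam_pos[OF i] by (simp add: mult_le_0_iff)
qed

lemma sum_slopes:
  "(\<Sum>i=1..n. lam i * y i * slope i)
    = g0 * moment n lam mu 0 y + g1 * moment n lam mu 1 y + g2 * moment n lam mu 2 y"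
  by (simp add: slope_def moment_def ring_distribs sum.distrib sum_distrib_left mult_ac)

text \<open>This is complementary slackness, weighted by the arrival rates at each queue and summed
  over all types.\<close>

lemma aggregate_slopes:
  "g0 * m 0 + g1 * m 1 + g2 * m 2 \<le> 0" "0 \<le> g0 * m' 0 + g1 * m' 1 + g2 * m' 2"
proof -
  have "lam i * x i * slope i \<le> 0" if "i \<in> {1..n}" for i
    using lam_pos[OF that] box(1)[OF that] slope_nonpos[OF that]
    by (cases "x i = 0") (auto intro: mult_nonneg_nonpos)
  then show "g0 * m 0 + g1 * m 1 + g2 * m 2 \<le> 0"
    unfolding sum_slopes[symmetric] by (rule sum_nonpos)
  have "0 \<le> lam i * (1 - x i) * slope i" if "i \<in> {1..n}" for i
    using lam_pos[OF that] box(2)[OF that] slope_nonneg[OF that]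
    by (cases "x i = 1") auto
  then show "0 \<le> g0 * m' 0 + g1 * m' 1 + g2 * m' 2"
    unfolding sum_slopes[symmetric] by (rule sum_nonneg)
qed

section \<open>The signs of the outer coefficients \<open>g0\<close> and \<open>g2\<close>\<close>

lemma not_evenly_split: "\<not> (m 0 = m' 0 \<and> m 2 = m' 2 \<and> s = r \<and> m 1 = m' 1)"
proof
  assume eq: "m 0 = m' 0 \<and> m 2 = m' 2 \<and> s = r \<and> m 1 = m' 1"
  define A B C where "A = (\<Sum>i=1..n. lam i)" and "B = (\<Sum>i=1..n. lam i / mu i)"
    and "C = (\<Sum>i=1..n. lam i / (mu i)\<^sup>2)"
  have tot: "m 0 + m' 0 = A" "m 1 + m' 1 = B" "m 2 + m' 2 = C"
    by (simp_all add: moment_compl A_def B_def C_def)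
  have half: "m 0 = A / 2" "m 2 = C / 2" "\<alpha> = 1 / 2" "s = (1 - B) / 2"
    using eq tot by (auto simp: field_simps)
  have pos: "A > 0" "C > 0" "B < 1" "B > 0"
    using moment_pos[of 0] moment_pos[of 2] half load moment_pos[of 1] moment_pos'[of 1] tot
    by (auto simp: B_def)
  \<comment> \<open>Halving all four factors leaves the quotient unchanged: each queue alone costs
    as much as the undivided server, which is available at the feasible point with
    \<open>x = 0\<close> and \<open>\<alpha> = 0\<close>.\<close>
  have "P = A * C / (1 - B)" unfolding queue_cost_def half(1,2,4) by (simp add: half(3))
  moreover have "Q = P"
  proof -
    have "1 - \<alpha> = \<alpha>" using half(3) by simp
    moreover have "m' 0 = m 0" "m' 2 = m 2" "m' 1 = m 1" using eq by simp_all
    ultimately show ?thesis unfolding queue_cost_def by (simp only:)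
  qed
  moreover have "waiting_time n lam mu x \<alpha> = (P + Q) / A"
    unfolding A_def by (rule waiting_time_interior[OF \<alpha>_bounds])
  ultimately have "waiting_time n lam mu x \<alpha> = 2 * (C / (1 - B))"
    using pos by simp
  moreover have "qpp_feasible n lam mu (\<lambda>_. 0) 0"
    by (simp add: qpp_feasible_def stable_set_def)
  then have "waiting_time n lam mu x \<alpha> \<le> waiting_time n lam mu (\<lambda>_. 0) 0" by (rule minimal)
  then have "waiting_time n lam mu x \<alpha> \<le> C / (1 - B)" by (simp add: waiting_time_def C_def B_def)
  moreover have "C / (1 - B) > 0" using pos by simp
  ultimately show False by linarith
qed

text \<open>If \<open>g1 < 0\<close>, \<open>first_order_contradiction\<close> applies. Otherwise
  the first aggregate is a sum of nonnegative terms that is at most 0, so all three coefficients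
  vanish and the split is even.\<close>

lemma not_both_nonneg: "\<not> (0 \<le> g0 \<and> 0 \<le> g2)"
proof
  assume g: "0 \<le> g0 \<and> 0 \<le> g2"
  have pos: "m 0 > 0" "m 1 > 0" "m 2 > 0" "s > 0" "m' 0 > 0" "m' 1 > 0" "m' 2 > 0" "r > 0"
    using moment_pos moment_pos' slack slack' by auto
  have cap: "s + m 1 = \<alpha>" "r + m' 1 = 1 - \<alpha>" by simp_all
  have cost: "P = m 0 * m 2 / ((s + m 1) * s)" "Q = m' 0 * m' 2 / ((r + m' 1) * r)"
    unfolding cap queue_cost_def by (rule refl)+
  have stat: "P * (1 / (s + m 1) + 1 / s) = Q * (1 / (r + m' 1) + 1 / r)"
    unfolding cap by (rule stationary_capacity)
  show False
  proof (cases "g1 < 0")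
    case True
    show False
      using first_order_contradiction[OF pos cost g0_def g1_def g2_def stat _ _ True aggregate_slopes] g
      by blast
  next
    case False
    then have "0 \<le> g0 * m 0" "0 \<le> g1 * m 1" "0 \<le> g2 * m 2" using g pos by auto
    then have "g0 * m 0 = 0" "g1 * m 1 = 0" "g2 * m 2 = 0" using aggregate_slopes(1) by linarith+
    then have "g0 = 0" "g1 = 0" "g2 = 0" using pos by auto
    then have "P / m 0 = Q / m' 0" "P / m 2 = Q / m' 2" "P / s = Q / r"
      by (auto simp: g0_def g1_def g2_def)
    then have "m 0 = m' 0 \<and> m 2 = m' 2 \<and> s = r \<and> m 1 = m' 1"
      by (rule all_gradients_zero[OF pos cost stat])
    then show False using not_evenly_split by blast
  qed
qed

section \<open>Threshold structure and exclusion of fractional types\<close>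

lemma slope_threshold:
  assumes "g0 < 0" "0 < g2" and i: "i \<in> {1..n}" and j: "j \<in> {1..n}" and less: "mu j < mu i" and "0 < x j"
  shows "x i = 1"
proof (rule ccontr)
  assume "x i \<noteq> 1"
  then have "0 \<le> slope i" using slope_nonneg[OF i] box(2)[OF i] by simp
  moreover have "slope j \<le> 0" using slope_nonpos[OF j] assms(6) by simp
  ultimately have "slope j * mu j \<le> 0" "0 \<le> slope i * mu i"
    using mu_pos[OF i] mu_pos[OF j] by (simp_all add: mult_nonpos_nonneg)
  \<comment> \<open>Multiplied by the service rate, the slope is strictly decreasing in that rate,
    since \<open>g0 < 0 < g2\<close>.\<close>
  moreover have "slope k * mu k = g0 * mu k + g1 + g2 / mu k" if "k \<in> {1..n}" for k
    using mu_pos[OF that] by (simp add: slope_def power2_eq_square ring_distribs)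
  ultimately have "g0 * mu j + g1 + g2 / mu j \<le> 0" "0 \<le> g0 * mu i + g1 + g2 / mu i"
    using i j by simp_all
  moreover have "g0 * mu i < g0 * mu j" "g2 / mu i < g2 / mu j"
    using assms(1,2) less mu_pos[OF j] by (simp_all add: divide_strict_left_mono)
  ultimately show False by linarith
qed

text \<open>Around a fractional type \<open>i\<close>, all faster types are in the first queue and
  all slower ones in the second. This ordering yields the sign conditions of
  \<open>second_order_direction\<close>, whose direction of negative curvature contradicts
  minimality.\<close>

lemma no_fractional:
  assumes g: "g0 < 0" "0 < g2" and i: "i \<in> {1..n}"
  shows "x i = 0 \<or> x i = 1"
proof (rule ccontr)
  assume "\<not> (x i = 0 \<or> x i = 1)"
  then have xi: "0 < x i" "x i < 1" using box[OF i] by auto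
  define u where "u = mu i"
  have u: "u > 0" using mu_pos[OF i] by (simp add: u_def)
  have fast: "x j = 0" if "j \<in> {1..n}" "mu j < u" for j
    using slope_threshold[OF g i, of j] that xi box[of j] by (force simp: u_def)
  have slow: "x j = 1" if "j \<in> {1..n}" "u < mu j" for j
    using slope_threshold[OF g _ i, of j] that xi by (force simp: u_def)
  \<comment> \<open>Termwise comparison: types present in the first queue have rate at least
    \<open>u\<close>, those in the second at most \<open>u\<close>.\<close>
  have split: "u * m 1 \<le> m 0" "u * m 2 \<le> m 1" "m' 0 \<le> u * m' 1" "m' 1 \<le> u * m' 2"
  proof -
    have step: "lam j * y / mu j ^ Suc k * u = lam j * y / mu j ^ k * (u / mu j)" for j k y
      by simp
    have weight: "0 \<le> lam j * y / mu j ^ k" if "j \<in> {1..n}" "0 \<le> y" for j k y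
      using that lam_pos[of j] mu_pos[of j] by simp
    have *: "lam j * y / mu j ^ Suc k * u \<le> lam j * y / mu j ^ k"
      if "j \<in> {1..n}" "u \<le> mu j \<or> y = 0" "0 \<le> y" for j k y
    proof (cases "y = 0")
      case False
      then have "u / mu j \<le> 1" using that mu_pos[of j] by simp
      from mult_left_mono[OF this weight[OF that(1,3), of k]] show ?thesis
        by (simp only: step mult_1_right)
    qed simp
    have **: "lam j * y / mu j ^ k \<le> lam j * y / mu j ^ Suc k * u"
      if "j \<in> {1..n}" "mu j \<le> u \<or> y = 0" "0 \<le> y" for j k y
    proof (cases "y = 0")
      case False
      then have "1 \<le> u / mu j" using that mu_pos[of j] by simp
      from mult_left_mono[OF this weight[OF that(1,3), of k]] show ?thesis
        by (simp only: step mult_1_right)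
    qed simp
    have "u * m (Suc k) \<le> m k" for k
      unfolding moment_def sum_distrib_left mult.commute[of u]
    proof (intro sum_mono *)
      fix j assume j: "j \<in> {1..n}"
      show "u \<le> mu j \<or> x j = 0" using fast[OF j] by linarith
      show "0 \<le> x j" by (rule box(1)[OF j])
    qed
    from this[of 0] this[of 1] show "u * m 1 \<le> m 0" "u * m 2 \<le> m 1" by (simp_all add: numeral_2_eq_2)
    have "m' k \<le> u * m' (Suc k)" for k
      unfolding moment_def sum_distrib_left mult.commute[of u]
    proof (intro sum_mono **)
      fix j assume j: "j \<in> {1..n}"
      show "mu j \<le> u \<or> 1 - x j = 0" using slow[OF j] by linarith
      show "0 \<le> 1 - x j" using box(2)[OF j] by simp
    qed
    from this[of 0] this[of 1] show "m' 0 \<le> u * m' 1" "m' 1 \<le> u * m' 2" by (simp_all add: numeral_2_eq_2)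
  qed
  have pos: "\<alpha> > 0" "1 - \<alpha> > 0" "s > 0" "r > 0" using \<alpha>_bounds slack slack' by auto
  define k l k' l' where "k = 1 / \<alpha>" and "l = 1 / s" and "k' = 1 / (1 - \<alpha>)" and "l' = 1 / r"
  define e1 e2 e1' e2' where "e1 = u / m 0" and "e2 = 1 / u / m 2"
    and "e1' = u / m' 0" and "e2' = 1 / u / m' 2"
  have kl: "0 < k" "k < l" "0 < k'" "k' < l'" and e: "0 < e1" "0 < e2" "0 < e1'" "0 < e2'"
    using pos moment_pos moment_pos' u
    by (simp_all add: k_def l_def k'_def l'_def e1_def e2_def e1'_def e2'_def frac_less2)
  have y: "k * l / (l - k) = 1 / m 1" "k' * l' / (l' - k') = 1 / m' 1"
  proof -
    have *: "1 / p * (1 / (p - b)) / (1 / (p - b) - 1 / p) = 1 / b"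
      if "p > 0" "p - b > 0" "b > 0" for p b :: real
    proof -
      have "1 / (p - b) - 1 / p = b * (1 / p * (1 / (p - b)))"
        using that by (simp add: diff_frac_eq)
      then show ?thesis using that by simp
    qed
    show "k * l / (l - k) = 1 / m 1" "k' * l' / (l' - k') = 1 / m' 1"
      unfolding k_def l_def k'_def l'_def using pos moment_pos moment_pos' by (intro *; simp)+
  qed
  \<comment> \<open>In each queue the reciprocal load lies between the two logarithmic derivatives,
    in opposite orders for the two queues.\<close>
  have "e1 \<le> 1 / m 1" "1 / m 1 \<le> e2" "1 / m' 1 \<le> e1'" "e2' \<le> 1 / m' 1"
    unfolding e1_def e2_def e1'_def e2'_def
    using split moment_pos[of 0] moment_pos[of 1] moment_pos[of 2]
      moment_pos'[of 0] moment_pos'[of 1] moment_pos'[of 2] u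
    by (simp_all add: field_simps)
  then have sgn: "(e1 - k * l / (l - k)) * (e2 - k * l / (l - k)) \<le> 0"
      "(e1' - k' * l' / (l' - k')) * (e2' - k' * l' / (l' - k')) \<le> 0"
    unfolding y by (auto simp: mult_le_0_iff)
  have stat_k: "P * (k + l) = Q * (k' + l')"
    using stationary_capacity by (simp add: k_def l_def k'_def l'_def)
  have stat_e: "P * (e1 + e2 + l) = Q * (e1' + e2' + l')"
  proof -
    have "slope i = 0" using slope_nonneg[OF i] slope_nonpos[OF i] xi by simp
    moreover have "u * slope i = u * g0 + g1 + g2 / u"
      using u by (simp add: slope_def u_def[symmetric] power2_eq_square ring_distribs)
    moreover have "\<dots> = P * (e1 + e2 + l) - Q * (e1' + e2' + l')"
      by (simp add: g0_def g1_def g2_def e1_def e2_def e1'_def e2'_def l_def l'_def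
          distrib_left right_diff_distrib diff_divide_distrib mult.commute)
    ultimately show ?thesis by simp
  qed
  obtain K where K: "P * ((e1 + e2 - K * k - (K - 1) * l)\<^sup>2 + (K * k)\<^sup>2 + ((K - 1) * l)\<^sup>2 - e1\<^sup>2 - e2\<^sup>2)
      + Q * ((e1' + e2' - K * k' - (K - 1) * l')\<^sup>2 + (K * k')\<^sup>2 + ((K - 1) * l')\<^sup>2 - e1'\<^sup>2 - e2'\<^sup>2) < 0"
    using second_order_direction[OF cost_pos kl e stat_k stat_e sgn] by blast
  \<comment> \<open>This speed makes the load \<open>m 1\<close> grow at rate 1, as
    \<open>second_order_direction\<close> presupposes; \<open>m 0\<close> and \<open>m 2\<close>
    then grow at rates \<open>u\<close> and \<open>1 / u\<close>.\<close>
  define d where "d = u / lam i"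
  have d: "lam i * d = u" "lam i * d / mu i = 1" "lam i * d / (mu i)\<^sup>2 = 1 / u"
    using lam_pos[OF i] u by (simp_all add: d_def u_def power2_eq_square)
  have in_box: "\<forall>\<^sub>F e in at_right 0. 0 \<le> x i + e * d \<and> x i + e * d \<le> 1"
  proof -
    have "((\<lambda>e. x i + e * d) \<longlongrightarrow> x i + 0 * d) (at_right 0)" by (intro tendsto_intros)
    then have "((\<lambda>e. x i + e * d) \<longlongrightarrow> x i) (at_right 0)" by simp
    from order_tendstoD(1)[OF this xi(1)] order_tendstoD(2)[OF this xi(2)]
    show ?thesis by eventually_elim auto
  qed
  define w w' where "w = e1 + e2 - K * k - (K - 1) * l" and "w' = e1' + e2' - K * k' - (K - 1) * l'"
  have "P * w + Q * - w' = 0"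
  proof -
    have "P * w = P * (e1 + e2 + l) - K * (P * (k + l))" by (simp add: w_def algebra_simps)
    also have "\<dots> = Q * w'" unfolding stat_k stat_e by (simp add: w'_def algebra_simps)
    finally show ?thesis by simp
  qed
  moreover have "u / m 0 + 1 / u / m 2 - K / \<alpha> - (K - 1) / s = w"
    "- u / m' 0 + - (1 / u) / m' 2 - - K / (1 - \<alpha>) - - (K - 1) / r = - w'"
    by (simp_all add: w_def w'_def e1_def e2_def e1'_def e2'_def k_def l_def k'_def l'_def diff_divide_distrib)
  ultimately have "0 \<le> P * (w\<^sup>2 + ((K / \<alpha>)\<^sup>2 + ((K - 1) / s)\<^sup>2 - (u / m 0)\<^sup>2 - (1 / u / m 2)\<^sup>2))
      + Q * ((- w')\<^sup>2 + ((- K / (1 - \<alpha>))\<^sup>2 + (- (K - 1) / r)\<^sup>2 - (- u / m' 0)\<^sup>2 - (- (1 / u) / m' 2)\<^sup>2))"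
    using two_line_costs_deriv2_nonneg[OF moment_pos moment_pos pos(1,3) moment_pos' moment_pos' pos(2,4)
        line_min[OF i in_box, of K, unfolded d(2,3), unfolded d(1)], of w "- w'"]
    unfolding queue_cost_def by blast
  also have "\<dots> = P * (w\<^sup>2 + ((K * k)\<^sup>2 + ((K - 1) * l)\<^sup>2 - e1\<^sup>2 - e2\<^sup>2))
      + Q * (w'\<^sup>2 + ((K * k')\<^sup>2 + ((K - 1) * l')\<^sup>2 - e1'\<^sup>2 - e2'\<^sup>2))"
    by (simp only: k_def l_def k'_def l'_def e1_def e2_def e1'_def e2'_def mult_1_right times_divide_eq_right
        minus_divide_left[symmetric] power2_minus)
  finally show False using K unfolding w_def w'_def by (simp add: algebra_simps)
qed

end

section \<open>From service rates to a threshold index\<close>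

lemma down_closed_interval:
  fixes S :: "nat set"
  assumes "S \<subseteq> {1..n}" and "\<And>i j. i \<in> {1..n} \<Longrightarrow> j \<in> S \<Longrightarrow> i < j \<Longrightarrow> i \<in> S"
  shows "\<exists>k\<in>{0..n}. S = {1..k}"
proof (cases "S = {}")
  case False
  have fin: "finite S" using assms(1) finite_subset by blast
  then have "Max S \<in> S" using False by simp
  moreover have "S = {1..Max S}"
  proof (rule set_eqI)
    fix i
    show "i \<in> S \<longleftrightarrow> i \<in> {1..Max S}"
    proof
      assume "i \<in> S"
      then show "i \<in> {1..Max S}" using assms(1) fin by auto
    next
      assume "i \<in> {1..Max S}"
      moreover have "Max S \<le> n" using assms(1) \<open>Max S \<in> S\<close> by auto
      ultimately show "i \<in> S"
        using assms(2)[of i "Max S"] \<open>Max S \<in> S\<close> by (cases "i = Max S") auto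
    qed
  qed
  ultimately show ?thesis using assms(1) by (intro bexI[of _ "Max S"]) auto
\<comment> \<open>The empty set is \<open>{1..0}\<close>.\<close>
qed (auto intro: bexI[of _ 0])

lemma (in interior_optimum) threshold_form:
  assumes decr: "\<And>i j. i \<in> {1..n} \<Longrightarrow> j \<in> {1..n} \<Longrightarrow> i < j \<Longrightarrow> mu j < mu i"
    and g: "g0 < 0" "0 < g2"
  shows "\<exists>k\<in>{0..n}. \<forall>i\<in>{1..n}. x i = (if i \<le> k then 1 else 0)"
proof -
  have "\<exists>k\<in>{0..n}. {i \<in> {1..n}. x i = 1} = {1..k}"
  proof (rule down_closed_interval)
    fix i j assume "i \<in> {1..n}" "j \<in> {i \<in> {1..n}. x i = 1}" "i < j"
    then show "i \<in> {i \<in> {1..n}. x i = 1}"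
      using slope_threshold[OF g, of i j] decr[of i j] by simp
  qed auto
  then obtain k where k: "k \<in> {0..n}" "{i \<in> {1..n}. x i = 1} = {1..k}" by blast
  have "x i = (if i \<le> k then 1 else 0)" if "i \<in> {1..n}" for i
    using no_fractional[OF g that] that k(2) by (auto simp: set_eq_iff)
  then show ?thesis using k(1) by blast
qed

theorem corollary1:
  fixes n :: nat and lam mu x :: "nat \<Rightarrow> real" and \<alpha> :: real
  assumes lam_pos: "\<And>i. i \<in> {1..n} \<Longrightarrow> 0 < lam i"
    and mu_pos: "\<And>i. i \<in> {1..n} \<Longrightarrow> 0 < mu i"
    and mu_decr: "\<And>i j. i \<in> {1..n} \<Longrightarrow> j \<in> {1..n} \<Longrightarrow> i < j \<Longrightarrow> mu j < mu i"
    and stable: "(\<Sum>i=1..n. lam i / mu i) < 1"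
    and opt: "qpp_optimal n lam mu x \<alpha>"
  shows "\<exists>k\<in>{0..n}.
           (\<forall>i\<in>{1..n}. x i = (if i \<le> k then 1 else 0)) \<or>
           (\<forall>i\<in>{1..n}. x i = (if i \<le> k then 0 else 1))"
proof -
  have feas: "qpp_feasible n lam mu x \<alpha>"
    and minimal: "\<And>y \<beta>. qpp_feasible n lam mu y \<beta> \<Longrightarrow>
      waiting_time n lam mu x \<alpha> \<le> waiting_time n lam mu y \<beta>"
    using opt by (auto simp: qpp_optimal_def)
  consider "\<forall>i\<in>{1..n}. x i = 0" | "\<forall>i\<in>{1..n}. x i = 1"
    | "\<exists>i\<in>{1..n}. x i \<noteq> 0" "\<exists>i\<in>{1..n}. x i \<noteq> 1" by blast
  then show ?thesis
  proof cases
    \<comment> \<open>Both queues are used, which rules out the two exceptional feasible points and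
      leaves \<open>0 < \<alpha> < 1\<close>.\<close>
    case 3
    then have "0 < \<alpha>" "\<alpha> < 1" "(\<Sum>i=1..n. lam i * x i / mu i) < \<alpha>"
      "\<alpha> < (\<Sum>i=1..n. lam i * x i / mu i) + 1 - (\<Sum>i=1..n. lam i / mu i)"
      "\<And>i. i \<in> {1..n} \<Longrightarrow> 0 \<le> x i \<and> x i \<le> 1"
      using feas by (auto simp: qpp_feasible_def stable_set_def)
    then interpret interior_optimum n lam mu x \<alpha>
      using lam_pos mu_pos stable 3 minimal
      by unfold_locales (auto simp: moment_compl, simp_all add: moment_def)
    interpret swapped: interior_optimum n lam mu "\<lambda>i. 1 - x i" "1 - \<alpha>" by (rule swap)
    \<comment> \<open>Exchanging the queues negates \<open>g0\<close> and \<open>g2\<close>, so they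
      are neither both nonnegative nor both nonpositive; their signs are strictly opposite.\<close>
    consider "g0 < 0" "0 < g2" | "0 < g0" "g2 < 0"
      using not_both_nonneg swapped.not_both_nonneg unfolding swap_g by linarith
    then show ?thesis
    proof cases
      case 1
      then show ?thesis using threshold_form[OF mu_decr] by blast
    next
      case 2
      then have "\<exists>k\<in>{0..n}. \<forall>i\<in>{1..n}. 1 - x i = (if i \<le> k then 1 else 0)"
        using swapped.threshold_form[OF mu_decr] unfolding swap_g by simp
      then obtain k where "k \<in> {0..n}" "\<forall>i\<in>{1..n}. 1 - x i = (if i \<le> k then 1 else 0)" ..
      then have "\<forall>i\<in>{1..n}. x i = (if i \<le> k then 0 else 1)"
        by (auto split: if_splits)
      then show ?thesis using \<open>k \<in> {0..n}\<close> by blast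
    qed
  \<comment> \<open>With \<open>k = 0\<close> the first alternative gives \<open>x = 0\<close> and
    the second \<open>x = 1\<close> on all types.\<close>
  qed (auto intro!: bexI[of _ 0])
qed

end
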